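(* Let $I_{xx},I_{yy},I_{zz},I_{B_R}$ be positive real numbers and let $I_{xy}$ be a real number. Put $I_{xx}'=I_{xx}+I_{B_R}$, $I_{zz}'=I_{zz}+I_{B_R}$, $\gamma=I_{xy}/(I_{B_R}+I_{zz})$, $$\alpha=\frac{(I_{xx}-I_{zz})(I_{xx}-I_{yy}+2I_{B_R}+I_{zz})}{2(I_{B_R}+I_{zz})(I_{xx}+I_{B_R})},\qquad \beta=-\frac{I_{xx}-I_{yy}-I_{zz}}{I_{B_R}+I_{zz}},\qquad u_1=2\alpha+\beta-1,$$ and $\sigma=-(I_{yy}-I_{xx}')(I_{yy}-I_{zz}')$. Suppose $\sigma<0$, let $\lambda=\sqrt{-\sigma/(I_{xx}'I_{zz}')}$, assume $\lambda\neq1$, and put $\varepsilon=\gamma/\lambda^2$. Let $\theta_x,\theta_z$ be the functions of $\tau$ with $\theta_x(0)=\theta_z(0)=0$ and $$\dot\theta_x=\varepsilon\bigl(\lambda\sin\tau\sin(\lambda\tau)-u_1\cos\tau(\cos(\lambda\tau)-1)\bigr),\qquad \dot\theta_z=\varepsilon\bigl(\lambda\cos\tau\sin(\lambda\tau)+u_1\sin\tau(\cos(\lambda\tau)-1)\bigr).$$ Then $$\theta_x=\frac{\varepsilon}{\lambda^2-1}\bigl[(u_1-\lambda^2)\sin\tau\cos(\lambda\tau)-\lambda(u_1-1)\cos\tau\sin(\lambda\tau)+u_1(\lambda^2-1)\sin\tau\bigr],$$ $$\theta_z=\frac{\varepsilon}{\lambda^2-1}\bigl[(u_1-\lambda^2)\cos\tau\cos(\lambda\tau)+\lambda(u_1-1)\sin\tau\sin(\lambda\tau)+u_1(\lambda^2-1)\cos\tau-(u_1-1)\lambda^2\bigr],$$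 and $$\theta_x^2+(\theta_z+\theta_{z0})^2=r(\tau)^2,\qquad \theta_{z0}=\frac{\gamma(u_1-1)}{\lambda^2-1},\qquad r(\tau)=\sqrt{A_0+A(\tau)},$$ where $$A_0=\frac{\varepsilon^2}{(\lambda^2-1)^2}\left(\frac{(u_1-\lambda^2)^2+\lambda^2(u_1-1)^2}{2}+u_1^2(\lambda^2-1)^2\right),$$ $$A(\tau)=\frac{\varepsilon^2}{(\lambda^2-1)^2}\left(\frac{(u_1-\lambda^2)^2-\lambda^2(u_1-1)^2}{2}\cos(2\lambda\tau)+2u_1(\lambda^2-1)(u_1-\lambda^2)\cos(\lambda\tau)\right).$$
   Context: The functions $\theta_x,\theta_z$ are Euler angles of a spacecraft platform carrying an unbalanced rotor, in the small-angle approximation in which $\dot\theta_x$ and $\dot\theta_z$ equal the platform's angular velocity components along the $x$ and $z$ axes; a dot denotes $d/d\tau$, where $\tau$ is dimensionless time, and the right-hand sides are the first-order angular velocities for the platform initially at rest. The numbers $I_{xx},I_{yy},I_{zz},I_{xy}$ are entries of the equivalent spin inertia tensor in the rotor frame, and $I_{B_R}$ is the transverse moment of inertia of the platform. The relation for $(\theta_x,\theta_z)$ describes a circle centred at $(0,-\theta_{z0})$ (precession) whose radius oscillates with frequencies $\lambda$ and $2\lambda$ (nutation). *)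

theory Defs
  imports "HOL-Analysis.Analysis"
begin

end

theory Submission
  imports Defs
begin

text \<open>
  The idea is to pass to the frame that turns with angular velocity \<open>1\<close>.  With
  \<open>a = u1 - lam\<^sup>2\<close>, \<open>b = lam (u1 - 1)\<close>, \<open>d = u1 (lam\<^sup>2 - 1)\<close> and
  \<open>k = \<epsilon> / (lam\<^sup>2 - 1)\<close>, the asserted solution, with its centre moved to the origin and
  \<open>i\<close> denoting the imaginary unit, reads
  \<open>(\<theta>z + \<theta>z0) + i \<theta>x = k exp (i \<tau>) ((a cos (lam \<tau>) + d) - i b sin (lam \<tau>))\<close>,
  that is, a (possibly degenerate) ellipse with semi-axes \<open>\<bar>k a\<bar>\<close>, \<open>\<bar>k b\<bar>\<close> and centre \<open>k d\<close>, run through with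
  frequency \<open>lam\<close> in the turning frame.

  That the given formulas are the solution only requires differentiating them, because a
  function on an interval is determined by its derivative and its value at one point
  (\<open>eq_on_interval_if_same_derivative\<close>).  The rotation
  \<open>exp (i \<tau>)\<close> does not affect the modulus, so the squared distance from the centre is
  \<open>k\<^sup>2 ((a cos (lam \<tau>) + d)\<^sup>2 + (b sin (lam \<tau>))\<^sup>2)\<close>, and the double-angle formula splits this
  into a constant part and parts of frequency \<open>lam\<close> and \<open>2 lam\<close>, namely \<open>A0 + A \<tau>\<close>
  (\<open>rotating_ellipse_norm\<close>).  Being a sum of two squares, it is nonnegative, so that it is
  indeed the square of \<open>r \<tau>\<close>.

  The hypothesis \<open>\<sigma> < 0\<close>, with positive moments of inertia, gives \<open>lam > 0\<close>.  Hence
  \<open>lam \<noteq> 1\<close> yields \<open>lam\<^sup>2 \<noteq> 1\<close>, and \<open>\<epsilon> = \<gamma> / lam\<^sup>2\<close> turns into \<open>\<epsilon> lam\<^sup>2 = \<gamma>\<close>, so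
  that \<open>\<theta>z0\<close> cancels the constant term of \<open>\<theta>z\<close>.
\<close>

lemma eq_on_interval_if_same_derivative:
  fixes f g f' :: "real \<Rightarrow> real"
  assumes T: "is_interval T" "t0 \<in> T" "t \<in> T"
    and f: "\<And>t. t \<in> T \<Longrightarrow> (f has_real_derivative f' t) (at t within T)"
    and g: "\<And>t. t \<in> T \<Longrightarrow> (g has_real_derivative f' t) (at t within T)"
    and init: "f t0 = g t0"
  shows "f t = g t"
proof -
  have "\<exists>c. \<forall>t\<in>T. f t - g t = c"
  proof (rule has_field_derivative_zero_constant)
    show "convex T"
      using T(1) by (rule is_interval_convex)
    show "((\<lambda>t. f t - g t) has_real_derivative 0) (at t within T)" if "t \<in> T" for t
      using DERIV_diff[OF f[OF that] g[OF that]] by simp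
  qed
  with T(2,3) have "f t - g t = f t0 - g t0"
    by metis
  with init show ?thesis
    by simp
qed

text \<open>
  The left-hand side is the squared modulus of
  \<open>k exp (i t) ((a cos p + d) - i b sin p)\<close>, where \<open>t\<close> drops out; the other equation is
  \<open>cos\<^sup>2 p = (1 + cos (2 p)) / 2\<close> and \<open>sin\<^sup>2 p = (1 - cos (2 p)) / 2\<close>.
\<close>

lemma rotating_ellipse_norm:
  fixes a b d k p t :: real
  defines "q \<equiv> k\<^sup>2 * ((a * cos p + d)\<^sup>2 + (b * sin p)\<^sup>2)"
  shows "(k * (a * sin t * cos p - b * cos t * sin p + d * sin t))\<^sup>2
       + (k * (a * cos t * cos p + b * sin t * sin p + d * cos t))\<^sup>2 = q"
    and "k\<^sup>2 * ((a\<^sup>2 + b\<^sup>2) / 2 + d\<^sup>2)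
       + k\<^sup>2 * ((a\<^sup>2 - b\<^sup>2) / 2 * cos (2 * p) + 2 * d * a * cos p) = q"
proof -
  have "(k * (a * sin t * cos p - b * cos t * sin p + d * sin t))\<^sup>2
      + (k * (a * cos t * cos p + b * sin t * sin p + d * cos t))\<^sup>2
      = q * ((sin t)\<^sup>2 + (cos t)\<^sup>2)"
    unfolding q_def by algebra
  then show "(k * (a * sin t * cos p - b * cos t * sin p + d * sin t))\<^sup>2
      + (k * (a * cos t * cos p + b * sin t * sin p + d * cos t))\<^sup>2 = q"
    by simp
  show "k\<^sup>2 * ((a\<^sup>2 + b\<^sup>2) / 2 + d\<^sup>2)
      + k\<^sup>2 * ((a\<^sup>2 - b\<^sup>2) / 2 * cos (2 * p) + 2 * d * a * cos p) = q"
    unfolding q_def cos_double_cos power_mult_distrib sin_squared_eq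
    by (simp add: field_simps power2_eq_square)
qed

theorem mainTheorem3:
  fixes Ixx Iyy Izz Ixy IBR :: real
    and Ixx' Izz' \<gamma> \<alpha> \<beta> u1 \<sigma> lam \<epsilon> \<theta>z0 A0 :: real
    and \<theta>x \<theta>z A r :: "real \<Rightarrow> real"
    and T :: "real set"
  assumes "Ixx > 0" and "Iyy > 0" and "Izz > 0" and "IBR > 0"
    and "Ixx' = Ixx + IBR"
    and "Izz' = Izz + IBR"
    and "\<gamma> = Ixy / (IBR + Izz)"
    and "\<alpha> = (Ixx - Izz) * (Ixx - Iyy + 2 * IBR + Izz) / (2 * (IBR + Izz) * (Ixx + IBR))"
    and "\<beta> = - ((Ixx - Iyy - Izz) / (IBR + Izz))"
    and "u1 = 2 * \<alpha> + \<beta> - 1"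
    and "\<sigma> = - ((Iyy - Ixx') * (Iyy - Izz'))"
    and "\<sigma> < 0"
    and "lam = sqrt (- \<sigma> / (Ixx' * Izz'))"
    and "lam \<noteq> 1"
    and "\<epsilon> = \<gamma> / lam\<^sup>2"
    and "is_interval T" and "0 \<in> T"
    and "\<theta>x 0 = 0" and "\<theta>z 0 = 0"
    and "\<And>\<tau>. \<tau> \<in> T \<Longrightarrow>
           (\<theta>x has_real_derivative
              \<epsilon> * (lam * sin \<tau> * sin (lam * \<tau>) - u1 * cos \<tau> * (cos (lam * \<tau>) - 1)))
           (at \<tau> within T)"
    and "\<And>\<tau>. \<tau> \<in> T \<Longrightarrow>
           (\<theta>z has_real_derivative
              \<epsilon> * (lam * cos \<tau> * sin (lam * \<tau>) + u1 * sin \<tau> * (cos (lam * \<tau>) - 1)))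
           (at \<tau> within T)"
    and "\<theta>z0 = \<gamma> * (u1 - 1) / (lam\<^sup>2 - 1)"
    and "A0 = \<epsilon>\<^sup>2 / (lam\<^sup>2 - 1)\<^sup>2 *
           (((u1 - lam\<^sup>2)\<^sup>2 + lam\<^sup>2 * (u1 - 1)\<^sup>2) / 2 + u1\<^sup>2 * (lam\<^sup>2 - 1)\<^sup>2)"
    and "\<And>\<tau>. A \<tau> = \<epsilon>\<^sup>2 / (lam\<^sup>2 - 1)\<^sup>2 *
           (((u1 - lam\<^sup>2)\<^sup>2 - lam\<^sup>2 * (u1 - 1)\<^sup>2) / 2 * cos (2 * lam * \<tau>)
             + 2 * u1 * (lam\<^sup>2 - 1) * (u1 - lam\<^sup>2) * cos (lam * \<tau>))"
    and "\<And>\<tau>. r \<tau> = sqrt (A0 + A \<tau>)"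
  shows "\<forall>\<tau>\<in>T.
      \<theta>x \<tau> = \<epsilon> / (lam\<^sup>2 - 1) *
        ((u1 - lam\<^sup>2) * sin \<tau> * cos (lam * \<tau>)
          - lam * (u1 - 1) * cos \<tau> * sin (lam * \<tau>)
          + u1 * (lam\<^sup>2 - 1) * sin \<tau>)
    \<and> \<theta>z \<tau> = \<epsilon> / (lam\<^sup>2 - 1) *
        ((u1 - lam\<^sup>2) * cos \<tau> * cos (lam * \<tau>)
          + lam * (u1 - 1) * sin \<tau> * sin (lam * \<tau>)
          + u1 * (lam\<^sup>2 - 1) * cos \<tau> - (u1 - 1) * lam\<^sup>2)
    \<and> A0 + A \<tau> \<ge> 0
    \<and> (\<theta>x \<tau>)\<^sup>2 + (\<theta>z \<tau> + \<theta>z0)\<^sup>2 = (r \<tau>)\<^sup>2"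
proof
  fix \<tau> assume \<tau>: "\<tau> \<in> T"
  note T = \<open>is_interval T\<close> \<open>0 \<in> T\<close>
  define k where "k = \<epsilon> / (lam\<^sup>2 - 1)"
  have "Ixx' * Izz' > 0"
    using assms(1-6) by simp
  with \<open>\<sigma> < 0\<close> have lam: "lam > 0"
    unfolding \<open>lam = sqrt _\<close> by (simp add: divide_neg_pos)
  have lam2: "lam\<^sup>2 - 1 \<noteq> 0"
    using lam \<open>lam \<noteq> 1\<close> by (simp add: power2_eq_1_iff)
  have \<epsilon>: "\<epsilon> = k * (lam\<^sup>2 - 1)"
    using lam2 by (simp add: k_def)
  have \<theta>z0: "\<theta>z0 = k * ((u1 - 1) * lam\<^sup>2)"
    using lam unfolding \<open>\<theta>z0 = _\<close> k_def \<open>\<epsilon> = \<gamma> / _\<close> by simp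

  let ?X = "\<lambda>\<tau>. k * ((u1 - lam\<^sup>2) * sin \<tau> * cos (lam * \<tau>)
          - lam * (u1 - 1) * cos \<tau> * sin (lam * \<tau>)
          + u1 * (lam\<^sup>2 - 1) * sin \<tau>)"
  let ?Z = "\<lambda>\<tau>. k * ((u1 - lam\<^sup>2) * cos \<tau> * cos (lam * \<tau>)
          + lam * (u1 - 1) * sin \<tau> * sin (lam * \<tau>)
          + u1 * (lam\<^sup>2 - 1) * cos \<tau> - (u1 - 1) * lam\<^sup>2)"
  have X: "\<theta>x \<tau> = ?X \<tau>"
  proof (rule eq_on_interval_if_same_derivative[OF T \<tau> assms(20)])
    show "(?X has_real_derivative
        \<epsilon> * (lam * sin t * sin (lam * t) - u1 * cos t * (cos (lam * t) - 1))) (at t within T)" for t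
      unfolding \<epsilon> by (rule derivative_eq_intros refl)+ (simp add: algebra_simps power2_eq_square)
  qed (use \<open>\<theta>x 0 = 0\<close> in simp_all)
  have Z: "\<theta>z \<tau> = ?Z \<tau>"
  proof (rule eq_on_interval_if_same_derivative[OF T \<tau> assms(21)])
    show "(?Z has_real_derivative
        \<epsilon> * (lam * cos t * sin (lam * t) + u1 * sin t * (cos (lam * t) - 1))) (at t within T)" for t
      unfolding \<epsilon> by (rule derivative_eq_intros refl)+ (simp add: algebra_simps power2_eq_square)
  qed (use \<open>\<theta>z 0 = 0\<close> in \<open>simp_all add: algebra_simps\<close>)

  define q where "q = k\<^sup>2 * (((u1 - lam\<^sup>2) * cos (lam * \<tau>) + u1 * (lam\<^sup>2 - 1))\<^sup>2
      + (lam * (u1 - 1) * sin (lam * \<tau>))\<^sup>2)"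
  have shift: "\<theta>z \<tau> + \<theta>z0 = k * ((u1 - lam\<^sup>2) * cos \<tau> * cos (lam * \<tau>)
      + lam * (u1 - 1) * sin \<tau> * sin (lam * \<tau>) + u1 * (lam\<^sup>2 - 1) * cos \<tau>)"
    unfolding Z \<theta>z0 by (simp add: algebra_simps)
  have circle: "(\<theta>x \<tau>)\<^sup>2 + (\<theta>z \<tau> + \<theta>z0)\<^sup>2 = q"
    unfolding X shift q_def by (rule rotating_ellipse_norm(1))
  have radius: "A0 + A \<tau> = q"
    using rotating_ellipse_norm(2)[of k "u1 - lam\<^sup>2" "lam * (u1 - 1)" "u1 * (lam\<^sup>2 - 1)" "lam * \<tau>"]
    unfolding q_def assms(23,24) k_def power_divide power_mult_distrib
    by (simp add: mult.assoc)
  have "q \<ge> 0"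
    unfolding q_def by simp
  then have "A0 + A \<tau> \<ge> 0" "(r \<tau>)\<^sup>2 = q"
    unfolding \<open>r \<tau> = _\<close> radius by simp_all
  with X Z circle show "\<theta>x \<tau> = \<epsilon> / (lam\<^sup>2 - 1) *
        ((u1 - lam\<^sup>2) * sin \<tau> * cos (lam * \<tau>)
          - lam * (u1 - 1) * cos \<tau> * sin (lam * \<tau>)
          + u1 * (lam\<^sup>2 - 1) * sin \<tau>)
    \<and> \<theta>z \<tau> = \<epsilon> / (lam\<^sup>2 - 1) *
        ((u1 - lam\<^sup>2) * cos \<tau> * cos (lam * \<tau>)
          + lam * (u1 - 1) * sin \<tau> * sin (lam * \<tau>)
          + u1 * (lam\<^sup>2 - 1) * cos \<tau> - (u1 - 1) * lam\<^sup>2)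
    \<and> A0 + A \<tau> \<ge> 0
    \<and> (\<theta>x \<tau>)\<^sup>2 + (\<theta>z \<tau> + \<theta>z0)\<^sup>2 = (r \<tau>)\<^sup>2"
    unfolding k_def by metis
qed

end
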